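(* Let $d\ge1$ and $X=\{x^1,x^2,\dots,x^m\}\subseteq[0,1]^d$ with $m\ge d+1$. Assume that $p\in\operatorname{conv}_{\oplus}(X)$. Then there exists $X'=\{x'^i : i\in I\}\subseteq X$ with $1\le|I|\le d+1$ such that $p\in\operatorname{conv}_{\oplus}(X')$.
   Context: For $a,b\in[0,1]$ put $a\oplus b=\max(a,b)$ and $a\otimes b=\min(a,b)$; these act on vectors of $[0,1]^d$ componentwise, with $(\lambda\otimes x)_k=\min(\lambda,x_k)$ for $\lambda\in[0,1]$, $x\in[0,1]^d$. A set $C\subseteq[0,1]^d$ is max-min convex if for all $x,y\in C$ and all $\alpha,\beta\in[0,1]$ with $\alpha\oplus\beta=1$ one has $\alpha\otimes x\oplus\beta\otimes y\in C$. For $X\subseteq[0,1]^d$, the convex hull $\operatorname{conv}_{\oplus}(X)$ is the smallest max-min convex set containing $X$; equivalently, the set of all combinations $\bigoplus_{i=1}^m\lambda_i\otimes x^i$ with $m\ge1$, $x^i\in X$, $\lambda_i\in[0,1]$, $\bigoplus_{i=1}^m\lambda_i=1$. *)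

theory Defs
  imports "HOL-Analysis.Analysis"
begin

definition mm_add :: "real ^ 'd \<Rightarrow> real ^ 'd \<Rightarrow> real ^ 'd"  (infixl "\<oplus>" 65)
  where "x \<oplus> y = (\<chi> k. max (x $ k) (y $ k))"

definition mm_scale :: "real \<Rightarrow> real ^ 'd \<Rightarrow> real ^ 'd"  (infixr "\<otimes>" 70)
  where "a \<otimes> x = (\<chi> k. min a (x $ k))"

(* The order on real ^ 'd is componentwise, so {0..1} is the unit cube. *)
definition mm_convex :: "(real ^ 'd) set \<Rightarrow> bool"
  where "mm_convex C \<longleftrightarrow>
    C \<subseteq> {0..1} \<and>
    (\<forall>x\<in>C. \<forall>y\<in>C. \<forall>\<alpha>\<in>{0..1}. \<forall>\<beta>\<in>{0..1}.
       max \<alpha> \<beta> = 1 \<longrightarrow> \<alpha> \<otimes> x \<oplus> \<beta> \<otimes> y \<in> C)"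

(* Meaningful for X inside the unit cube only: otherwise the intersection is over the
   empty family and yields UNIV. *)
definition mm_conv :: "(real ^ 'd) set \<Rightarrow> (real ^ 'd) set"
  where "mm_conv X = mm_convex hull X"

lemma mm_convex_unit_cube: "mm_convex {0..1 :: real ^ 'd}"
  by (auto simp: mm_convex_def mm_add_def mm_scale_def less_eq_vec_def le_max_iff_disj
      min_le_iff_disj)

lemma mm_convex_mm_conv:
  assumes "X \<subseteq> {0..1 :: real ^ 'd}"
  shows "mm_convex (mm_conv X)"
proof -
  have "mm_conv X \<subseteq> {0..1}"
    unfolding mm_conv_def using assms mm_convex_unit_cube by (rule hull_minimal)
  then show ?thesis
    unfolding mm_convex_def[of "mm_conv X"]
    by (auto simp: mm_conv_def hull_def mm_convex_def)
qed

lemma mm_conv_superset: "X \<subseteq> mm_conv X"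
  unfolding mm_conv_def by (rule hull_subset)

lemma mm_conv_minimal: "X \<subseteq> C \<Longrightarrow> mm_convex C \<Longrightarrow> mm_conv X \<subseteq> C"
  unfolding mm_conv_def by (rule hull_minimal)

end

theory Submission
  imports Defs
begin

text \<open>
  A point of the max-min hull of \<open>X\<close> dominates some point of \<open>X\<close> (one whose coefficient is 1), and
  each of its \<open>d\<close> coordinates is attained by a multiple of a single point of \<open>X\<close> lying below it.
  The points with these two properties form a max-min convex set, so they contain the hull.
  Conversely, one dominated point together with one witness per coordinate, hence at most \<open>d + 1\<close>
  points, already generates the given point.
\<close>

lemma mm_add_nth [simp]: "(x \<oplus> y) $ k = max (x $ k) (y $ k)"
  by (simp add: mm_add_def)

lemma mm_scale_nth [simp]: "(a \<otimes> x) $ k = min a (x $ k)"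
  by (simp add: mm_scale_def)

lemma mm_scale_one: "x \<le> 1 \<Longrightarrow> 1 \<otimes> x = x"
  by (simp add: vec_eq_iff less_eq_vec_def min_absorb2)

lemma mm_add_least: "x \<le> z \<Longrightarrow> y \<le> z \<Longrightarrow> x \<oplus> y \<le> z"
  by (simp add: less_eq_vec_def)

lemma mm_add_upper1: "x \<le> x \<oplus> y"
  by (simp add: less_eq_vec_def)

lemma mm_add_upper2: "y \<le> x \<oplus> y"
  by (simp add: less_eq_vec_def)

lemma mm_scale_mono: "x \<le> y \<Longrightarrow> a \<otimes> x \<le> a \<otimes> y"
  by (auto simp: less_eq_vec_def min_le_iff_disj)

lemma mm_scale_scale: "a \<otimes> b \<otimes> x = min a b \<otimes> x"
  by (simp add: vec_eq_iff min.assoc)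

text \<open>Each witness involves a single point of \<open>X\<close>, so it survives shrinking
  \<open>X\<close> to \<open>{y}\<close>. This is what later allows one point per coordinate to be
  counted.\<close>

definition touches :: "(real ^ 'd) set \<Rightarrow> real ^ 'd \<Rightarrow> 'd \<Rightarrow> bool"
  where "touches X p k \<longleftrightarrow> (\<exists>y\<in>X. \<exists>a\<in>{0..1}. a \<otimes> y \<le> p \<and> (a \<otimes> y) $ k = p $ k)"

text \<open>The same point \<open>y\<close> serves, with its coefficient cut down to
  \<open>min a b\<close>, because scaling is monotone.\<close>

lemma touches_scale:
  assumes "touches X u k" "a \<in> {0..1}"
  shows "touches X (a \<otimes> u) k"
proof -
  obtain y b where y: "y \<in> X" "b \<in> {0..1}" "b \<otimes> y \<le> u" "(b \<otimes> y) $ k = u $ k"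
    using assms(1) by (auto simp: touches_def)
  have "min a b \<in> {0..1}" "min a b \<otimes> y \<le> a \<otimes> u"
    using assms(2) y mm_scale_mono[of "b \<otimes> y" u a] by (auto simp: mm_scale_scale)
  moreover have "(min a b \<otimes> y) $ k = (a \<otimes> u) $ k"
    using y(4) by (simp add: min.assoc)
  ultimately show ?thesis
    using y(1) unfolding touches_def by blast
qed

lemma touches_mono:
  "touches X u k \<Longrightarrow> u \<le> p \<Longrightarrow> u $ k = p $ k \<Longrightarrow> touches X p k"
  unfolding touches_def by (metis order_trans)

text \<open>At coordinate \<open>k\<close> the join agrees with the larger summand, and the witness
  of that summand stays below the join.\<close>

lemma touches_add:
  assumes "touches X u k" "touches X v k"
  shows "touches X (u \<oplus> v) k"
proof (cases "v $ k \<le> u $ k")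
  case True
  then show ?thesis
    by (intro touches_mono[OF assms(1)]) (auto simp: mm_add_upper1)
next
  case False
  then show ?thesis
    by (intro touches_mono[OF assms(2)]) (auto simp: mm_add_upper2)
qed

lemma mm_convex_touching:
  "mm_convex {p \<in> {0..1}. (\<exists>x\<in>X. x \<le> p) \<and> (\<forall>k. touches X p k)}" (is "mm_convex ?C")
  unfolding mm_convex_def
proof (intro conjI ballI impI)
  show "?C \<subseteq> {0..1}" by blast
next
  fix u v :: "real ^ 'a" and a b :: real
  assume u: "u \<in> ?C" and v: "v \<in> ?C" and ab: "a \<in> {0..1}" "b \<in> {0..1}" "max a b = 1"
  let ?p = "a \<otimes> u \<oplus> b \<otimes> v"
  have "?p \<in> {0..1}"
    using u v ab mm_convex_unit_cube unfolding mm_convex_def by blast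
  moreover have "\<exists>x\<in>X. x \<le> ?p"
  \<comment> \<open>Since \<open>max a b = 1\<close>, one coefficient equals 1. Its summand enters
    unscaled, so the point of \<open>X\<close> below it is also below \<open>?p\<close>.\<close>
  proof (cases "a = 1")
    case True
    then have "u \<le> ?p" using u by (simp add: mm_scale_one mm_add_upper1)
    then show ?thesis using u by (blast intro: order_trans)
  next
    case False
    then have "b = 1" using ab(3) by (auto simp: max_def split: if_splits)
    then have "v \<le> ?p" using v by (simp add: mm_scale_one mm_add_upper2)
    then show ?thesis using v by (blast intro: order_trans)
  qed
  moreover have "\<forall>k. touches X ?p k"
    using u v ab by (blast intro: touches_add touches_scale)
  ultimately show "?p \<in> ?C" by blast
qed

lemma mm_conv_touching:
  assumes "X \<subseteq> {0..1}" "p \<in> mm_conv X"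
  shows "\<exists>x\<in>X. x \<le> p" and "touches X p k"
proof -
  let ?C = "{p \<in> {0..1}. (\<exists>x\<in>X. x \<le> p) \<and> (\<forall>k. touches X p k)}"
  have "touches X x k" if "x \<in> X" for x k
  proof -
    have "x \<in> {0..1}" using that assms(1) by blast
    then have "1 \<otimes> x = x" by (simp add: mm_scale_one)
    then show ?thesis
      using that unfolding touches_def by (intro bexI[of _ x] bexI[of _ 1]) auto
  qed
  then have "X \<subseteq> ?C" using assms(1) by blast
  then have "p \<in> ?C" using mm_conv_minimal[OF _ mm_convex_touching] assms(2) by blast
  then show "\<exists>x\<in>X. x \<le> p" and "touches X p k" by blast+
qed

text \<open>Start from \<open>x\<close> and join the witnesses one coordinate at a time. Every join
  stays below \<open>p\<close>, so a coordinate that has reached its value in \<open>p\<close> keeps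
  it.\<close>

lemma mm_convI_touching:
  fixes p :: "real ^ 'd"
  assumes "X \<subseteq> {0..1}" "x \<in> X" "x \<le> p" "\<And>k. touches X p k"
  shows "p \<in> mm_conv X"
proof -
  have conv: "mm_convex (mm_conv X)"
    using assms(1) by (rule mm_convex_mm_conv)
  have "\<exists>q\<in>mm_conv X. q \<le> p \<and> (\<forall>k\<in>K. q $ k = p $ k)" if "finite K" for K
    using that
  proof (induction K)
    case empty
    then show ?case using assms(2,3) mm_conv_superset by auto
  next
    case (insert k K)
    then obtain q where q: "q \<in> mm_conv X" "q \<le> p" "\<forall>k\<in>K. q $ k = p $ k"
      by blast
    obtain y a where y: "y \<in> X" "a \<in> {0..1}" "a \<otimes> y \<le> p" "(a \<otimes> y) $ k = p $ k"
      using assms(4)[of k] by (auto simp: touches_def)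
    have "q \<le> 1" using conv q(1) by (auto simp: mm_convex_def)
    \<comment> \<open>The coefficient 1 on \<open>q\<close> makes the combination admissible
      whatever \<open>a\<close> is; this is why the induction needs a hull point below
      \<open>p\<close> to start from.\<close>
    have "1 \<otimes> q \<oplus> a \<otimes> y \<in> mm_conv X"
      using conv q(1) y(1,2) mm_conv_superset[of X] unfolding mm_convex_def by auto
    then have "q \<oplus> a \<otimes> y \<in> mm_conv X"
      using \<open>q \<le> 1\<close> by (simp add: mm_scale_one)
    moreover have le: "q \<oplus> a \<otimes> y \<le> p"
      using q(2) y(3) by (rule mm_add_least)
    moreover have "(q \<oplus> a \<otimes> y) $ j = p $ j" if "j \<in> insert k K" for j
    proof (rule antisym)
      show "(q \<oplus> a \<otimes> y) $ j \<le> p $ j"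
        using le unfolding less_eq_vec_def by blast
      show "p $ j \<le> (q \<oplus> a \<otimes> y) $ j"
        using that q(3) y(4) by (auto simp: le_max_iff_disj)
    qed
    ultimately show ?case by blast
  qed
  from this[of UNIV] obtain q where "q \<in> mm_conv X" "\<forall>k. q $ k = p $ k"
    by auto
  then show ?thesis by (simp add: vec_eq_iff[symmetric])
qed

lemma mm_caratheodory:
  fixes p :: "real ^ 'd"
  assumes "X \<subseteq> {0..1}" "p \<in> mm_conv X"
  obtains Y where "Y \<subseteq> X" "finite Y" "Y \<noteq> {}" "card Y \<le> CARD('d) + 1" "p \<in> mm_conv Y"
proof -
  obtain x where x: "x \<in> X" "x \<le> p"
    using mm_conv_touching(1)[OF assms] by blast
  have "\<forall>k. \<exists>y\<in>X. touches {y} p k"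
    using mm_conv_touching(2)[OF assms] by (auto simp: touches_def)
  then obtain y where y: "\<And>k. y k \<in> X" "\<And>k. touches {y k} p k"
    by metis
  \<comment> \<open>One point for domination and at most \<open>CARD('d)\<close> coordinate
    witnesses; coincidences among them only lower the count.\<close>
  let ?Y = "insert x (range y)"
  have "card ?Y \<le> Suc (card (range y))"
    by (rule card_insert_le_m1) simp_all
  also have "\<dots> \<le> CARD('d) + 1"
    by (simp add: card_image_le)
  finally have card: "card ?Y \<le> CARD('d) + 1" .
  have sub: "?Y \<subseteq> X" using x y by blast
  have "touches ?Y p k" for k
    using y(2)[of k] by (auto simp: touches_def)
  then have "p \<in> mm_conv ?Y"
    using sub assms(1) x(2) by (intro mm_convI_touching[of ?Y x]) auto
  with sub card show thesis by (intro that[of ?Y]) auto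
qed

theorem theorem7:
  fixes x :: "nat \<Rightarrow> real ^ 'd" and X :: "(real ^ 'd) set" and m :: nat and p :: "real ^ 'd"
  assumes "X = x ` {1..m}"
    and "X \<subseteq> {0..1}"
    and "m \<ge> CARD('d) + 1"
    and "p \<in> mm_conv X"
  shows "\<exists>(I :: nat set) x' X'. X' = x' ` I \<and> X' \<subseteq> X \<and>
           finite I \<and> 1 \<le> card I \<and> card I \<le> CARD('d) + 1 \<and> p \<in> mm_conv X'"
proof -
  obtain Y where Y: "Y \<subseteq> X" "finite Y" "Y \<noteq> {}" "card Y \<le> CARD('d) + 1" "p \<in> mm_conv Y"
    using mm_caratheodory[OF assms(2,4)] .
  \<comment> \<open>An injective enumeration of \<open>Y\<close> gives the index set exactly
    \<open>card Y\<close> elements, so the bounds on \<open>card Y\<close> carry over to it.\<close>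
  obtain h where h: "bij_betw h {0..<card Y} Y"
    using ex_bij_betw_nat_finite[OF Y(2)] by blast
  have "1 \<le> card Y"
    using Y(2,3) by (simp add: Suc_le_eq card_gt_0_iff)
  then show ?thesis
    using Y h by (intro exI[of _ "{0..<card Y}"] exI[of _ h] exI[of _ Y])
      (auto simp: bij_betw_def)
qed

end
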